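(* Let $c_0=K_0h^{\gamma_0}$, $c_1=K_1h^{\gamma_1}$, $c_2=1-K_0h^{\gamma_0}-K_1h^{\gamma_1}$ be the optimal weights, with $K_0,K_1\in\mathbb{R}_{>0}$, $\gamma_1\ge 0$, $\gamma_0\ge 1$ and $\gamma_0\ge\gamma_1$, and let $P=\omega_0P_0+\omega_1P_1+\omega_2P_2$, where $P_0,P_1,P_2$ are the polynomials defined in the context from the cell averages of $u$, and where the ($h$-dependent) weights satisfy $\omega_i\ge 0$, $\omega_0+\omega_1+\omega_2=1$. If $u$ is smooth enough in the stencil $S_2=[x_0,x_0+3h]$ and, as $h\to0$, $$\omega_0=c_0+O(h^2),\qquad \omega_1=c_1+O(h),\qquad \omega_2=c_2+O(h),$$ then $$u(x)-P(x)=O(h^3)\qquad\forall x\in S_2.$$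
   Context: Grid: $h>0$ is the mesh size, $x_0\in\mathbb{R}$ is the (fixed) left boundary point, $x_j=x_0+jh$ (for integer and half-integer $j$), and for $j\in\{0.5,1.5,2.5\}$ the cells are $I_j=[x_j-\tfrac h2,x_j+\tfrac h2]$. Stencils: $S_0=I_{0.5}$, $S_1=I_{0.5}\cup I_{1.5}$, $S_2=I_{0.5}\cup I_{1.5}\cup I_{2.5}$. Cell averages of a function $u$: $\bar u_j=\frac1h\int_{I_j}u(x)\,dx$. Polynomials: with $\sigma_l=\bar u_{1.5}-\bar u_{0.5}$ and $\sigma_r=\bar u_{2.5}-\bar u_{1.5}$, $$P_0(x)=\bar u_{0.5},\qquad P_1(x)=\bar u_{1.5}+\frac{\sigma_l}{h}(x-x_{1.5}),$$ $$P_2(x)=\frac1{c_2}\Big(-c_0\bar u_{0.5}+(1-c_1)\bar u_{1.5}-\tfrac1{24}(\sigma_r-\sigma_l)+\frac{\sigma_r+\sigma_l-2c_1\sigma_l}{2h}(x-x_{1.5})+\frac{\sigma_r-\sigma_l}{2h^2}(x-x_{1.5})^2\Big).$$ Equivalently, $c_0P_0+c_1P_1+c_2P_2=P_{opt}$, the unique parabola whose cell averages over $I_{0.5},I_{1.5},I_{2.5}$ are $\bar u_{0.5},\bar u_{1.5},\bar u_{2.5}$. The weights $c_i$ are required to satisfy $c_i>0$ (for all sufficiently small $h$); they sum to $1$. Asymptotics: all $O(\cdot)$ are for $h\to0$ with the constants $K_i,\gamma_i$ and the function $u$ fixed; estimates "$\forall x\in S_2$" are uniform in $x\in S_2$. "Smooth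 enough" means $C^k$ with $k$ sufficiently large on $S_2$ for all sufficiently small $h$ (i.e. on $[x_0,x_0+3h_0]$ for some $h_0>0$). *)

theory Defs
  imports "HOL-Analysis.Analysis" "HOL-Library.Landau_Symbols"
begin

text \<open>Here \<open>D j\<close> is the \<open>j\<close>-th derivative of \<open>f\<close> on \<open>S\<close>. Derivatives are taken within \<open>S\<close>,
  hence one-sided at the endpoints of a compact interval, and \<open>f\<close> is unconstrained outside \<open>S\<close>.\<close>

definition C_k_on :: "nat \<Rightarrow> (real \<Rightarrow> real) \<Rightarrow> real set \<Rightarrow> bool" where
  "C_k_on k f S \<longleftrightarrow> (\<exists>D :: nat \<Rightarrow> real \<Rightarrow> real.
     (\<forall>x\<in>S. D 0 x = f x) \<and>
     (\<forall>j<k. \<forall>x\<in>S. (D j has_real_derivative D (Suc j) x) (at x within S)) \<and>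
     continuous_on S (D k))"

definition grid :: "real \<Rightarrow> real \<Rightarrow> real \<Rightarrow> real" where
  "grid x0 h j = x0 + j * h"

definition cell :: "real \<Rightarrow> real \<Rightarrow> real \<Rightarrow> real set" where
  "cell x0 h j = {grid x0 h j - h / 2 .. grid x0 h j + h / 2}"

definition stencil2 :: "real \<Rightarrow> real \<Rightarrow> real set" where
  "stencil2 x0 h = cell x0 h (1/2) \<union> cell x0 h (3/2) \<union> cell x0 h (5/2)"

definition cell_avg :: "(real \<Rightarrow> real) \<Rightarrow> real \<Rightarrow> real \<Rightarrow> real \<Rightarrow> real" where
  "cell_avg u x0 h j = (1 / h) * integral (cell x0 h j) u"

definition sigma_l :: "(real \<Rightarrow> real) \<Rightarrow> real \<Rightarrow> real \<Rightarrow> real" where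
  "sigma_l u x0 h = cell_avg u x0 h (3/2) - cell_avg u x0 h (1/2)"

definition sigma_r :: "(real \<Rightarrow> real) \<Rightarrow> real \<Rightarrow> real \<Rightarrow> real" where
  "sigma_r u x0 h = cell_avg u x0 h (5/2) - cell_avg u x0 h (3/2)"

text \<open>The weights \<open>c\<^sub>0\<close> and \<open>c\<^sub>1\<close> are both of the form \<open>opt_weight K \<gamma> h\<close>. The mesh size \<open>h\<close> is
  always positive, so \<open>powr\<close> is the usual real power.\<close>

definition opt_weight :: "real \<Rightarrow> real \<Rightarrow> real \<Rightarrow> real" where
  "opt_weight K \<gamma> h = K * h powr \<gamma>"

definition opt_weight2 :: "real \<Rightarrow> real \<Rightarrow> real \<Rightarrow> real \<Rightarrow> real \<Rightarrow> real" where
  "opt_weight2 K0 \<gamma>0 K1 \<gamma>1 h = 1 - K0 * h powr \<gamma>0 - K1 * h powr \<gamma>1"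

definition P_0 :: "(real \<Rightarrow> real) \<Rightarrow> real \<Rightarrow> real \<Rightarrow> real \<Rightarrow> real" where
  "P_0 u x0 h x = cell_avg u x0 h (1/2)"

definition P_1 :: "(real \<Rightarrow> real) \<Rightarrow> real \<Rightarrow> real \<Rightarrow> real \<Rightarrow> real" where
  "P_1 u x0 h x = cell_avg u x0 h (3/2) + sigma_l u x0 h / h * (x - grid x0 h (3/2))"

text \<open>\<open>P_2\<close> is chosen so that \<open>c0 * P_0 + c1 * P_1 + c2 * P_2\<close> is the unique parabola with the
  same averages as \<open>u\<close> over the three cells.\<close>

definition P_2 ::
  "real \<Rightarrow> real \<Rightarrow> real \<Rightarrow> (real \<Rightarrow> real) \<Rightarrow> real \<Rightarrow> real \<Rightarrow> real \<Rightarrow> real" where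
  "P_2 c0 c1 c2 u x0 h x = (1 / c2) *
     (- c0 * cell_avg u x0 h (1/2) + (1 - c1) * cell_avg u x0 h (3/2)
      - (1/24) * (sigma_r u x0 h - sigma_l u x0 h)
      + (sigma_r u x0 h + sigma_l u x0 h - 2 * c1 * sigma_l u x0 h) / (2 * h)
          * (x - grid x0 h (3/2))
      + (sigma_r u x0 h - sigma_l u x0 h) / (2 * h\<^sup>2) * (x - grid x0 h (3/2))\<^sup>2)"

end

theory Submission
  imports Defs
begin

text \<open>
  The candidates approximate \<open>u\<close> with different orders on the whole stencil: the constant
  \<open>P_0\<close> with error \<open>O(h)\<close>, the line \<open>P_1\<close> with error \<open>O(h\<^sup>2)\<close>, and the parabola
  \<open>optimal_parabola\<close>, which equals \<open>c0 * P_0 + c1 * P_1 + c2 * P_2\<close>, with error \<open>O(h\<^sup>3)\<close>.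
  In each case the reason is the same: the candidate is a linear function of the cell averages,
  with coefficients that are bounded on the stencil uniformly in \<open>h\<close>, and it reproduces
  polynomials up to its own degree, so that only the remainder of a Taylor expansion at \<open>x0\<close>
  contributes to the error.

  The order of \<open>P_2\<close> follows by solving for it:
  \<open>c2 * (u - P_2) = (u - optimal_parabola) - c0 * (u - P_0) - c1 * (u - P_1)\<close>.
  Here \<open>c0 = O(h)\<close> because \<open>\<gamma>0 \<ge> 1\<close>, while \<open>c1 \<le> 1\<close>, and \<open>c2\<close> is bounded away from \<open>0\<close>
  (lemma \<open>opt_weight2_bounded_away_from_0\<close>), whence \<open>u - P_2 = O(h\<^sup>2)\<close>.

  As both sets of weights sum to \<open>1\<close>, the error of \<open>P\<close> splits as
  \<open>(u - optimal_parabola) + (\<Sum>i. (\<omega>i - ci) * (u - P_i))\<close>, and each summand is \<open>O(h\<^sup>3)\<close>: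
  the weight that is accurate to second order multiplies the first-order candidate, and the
  weights that are accurate to first order multiply the second-order candidates.
\<close>

section \<open>Taylor expansion at the left boundary point\<close>

lemma C_k_on_mono:
  assumes "C_k_on k f S" "j \<le> k"
  shows "C_k_on j f S"
proof -
  obtain D where D: "\<forall>x\<in>S. D 0 x = f x"
      "\<forall>i<k. \<forall>x\<in>S. (D i has_real_derivative D (Suc i) x) (at x within S)"
      "continuous_on S (D k)"
    using assms(1) unfolding C_k_on_def by blast
  have "continuous_on S (D j)"
    using D assms(2) by (metis DERIV_continuous_on le_neq_implies_less)
  with D assms(2) show ?thesis
    unfolding C_k_on_def by (meson order_less_le_trans)
qed

lemma C_k_on_continuous:
  assumes "C_k_on k f S"
  shows "continuous_on S f"
proof -
  obtain D :: "nat \<Rightarrow> real \<Rightarrow> real"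
    where "\<forall>x\<in>S. D 0 x = f x" "continuous_on S (D 0)"
    using C_k_on_mono[OF assms, of 0] unfolding C_k_on_def by blast
  then show ?thesis by (metis continuous_on_cong)
qed

lemma C_k_on_Taylor:
  assumes "C_k_on (Suc n) u {a..b}" "a \<le> b"
  shows "\<exists>t M. M \<ge> 0 \<and>
    (\<forall>x\<in>{a..b}. \<bar>u x - (\<Sum>i\<le>n. t i * (x - a) ^ i)\<bar> \<le> M * (x - a) ^ Suc n)"
proof -
  obtain D where D0: "\<And>x. x \<in> {a..b} \<Longrightarrow> D 0 x = u x"
    and D: "\<And>i x. i \<le> n \<Longrightarrow> x \<in> {a..b} \<Longrightarrow>
          (D i has_field_derivative D (Suc i) x) (at x within {a..b})"
    and cont: "continuous_on {a..b} (D (Suc n))"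
    using assms(1) unfolding C_k_on_def less_Suc_eq_le by blast
  have "bounded (D (Suc n) ` {a..b})"
    by (intro compact_imp_bounded compact_continuous_image cont compact_Icc)
  then obtain B where B: "B > 0" "\<And>x. x \<in> {a..b} \<Longrightarrow> norm (D (Suc n) x) \<le> B"
    unfolding bounded_pos by auto
  have "\<bar>u x - (\<Sum>i\<le>n. (D i a / fact i) * (x - a) ^ i)\<bar> \<le> B / fact n * (x - a) ^ Suc n"
    if x: "x \<in> {a..b}" for x
  proof -
    have "norm (D 0 x - (\<Sum>i\<le>n. D i a * (x - a) ^ i / fact i)) \<le> B * norm (x - a) ^ Suc n / fact n"
      by (rule field_Taylor[of "{a..b}"]) (use D B x assms(2) in auto)
    then show ?thesis using D0[OF x] x by simp
  qed
  then show ?thesis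
    using B(1) by (intro exI[of _ "\<lambda>i. D i a / fact i"] exI[of _ "B / fact n"]) auto
qed

section \<open>Cell averages\<close>

lemma stencil2_eq:
  assumes "h > 0"
  shows "stencil2 x0 h = {x0 .. x0 + 3 * h}"
  using assms unfolding stencil2_def cell_def grid_def by (auto simp: field_simps)

lemma cell_eq: "cell x0 h j = {x0 + (j - 1/2) * h .. x0 + (j + 1/2) * h}"
  unfolding cell_def grid_def by (simp add: algebra_simps)

lemma has_integral_quadratic_cell:
  fixes a b c :: real
  assumes "h > 0"
  shows "((\<lambda>x. a + b * (x - x0) + c * (x - x0)\<^sup>2) has_integral
           h * (a + b * (j * h) + c * (h\<^sup>2 * (j\<^sup>2 + 1/12)))) (cell x0 h j)"
proof -
  define F where "F x = a * (x - x0) + b * (x - x0)\<^sup>2 / 2 + c * (x - x0) ^ 3 / 3" for x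
  have "((\<lambda>x. a + b * (x - x0) + c * (x - x0)\<^sup>2) has_integral
          (F (x0 + (j + 1/2) * h) - F (x0 + (j - 1/2) * h))) (cell x0 h j)"
    unfolding cell_eq
  proof (rule fundamental_theorem_of_calculus)
    show "x0 + (j - 1/2) * h \<le> x0 + (j + 1/2) * h" using assms by (simp add: algebra_simps)
  next
    fix x
    show "(F has_vector_derivative a + b * (x - x0) + c * (x - x0)\<^sup>2)
        (at x within {x0 + (j - 1/2) * h .. x0 + (j + 1/2) * h})"
      unfolding F_def has_real_derivative_iff_has_vector_derivative[symmetric]
      by (auto intro!: derivative_eq_intros simp: power2_eq_square)
  qed
  also have "F (x0 + (j + 1/2) * h) - F (x0 + (j - 1/2) * h) =
      h * (a + b * (j * h) + c * (h\<^sup>2 * (j\<^sup>2 + 1/12)))"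
    unfolding F_def by (simp add: field_simps power2_eq_square power3_eq_cube)
  finally show ?thesis .
qed

text \<open>Averaging does not increase a uniform error. The summand \<open>1/12\<close> is the variance of the
  uniform distribution on an interval of unit length, by which the average of the square exceeds
  the square at the midpoint.\<close>

lemma cell_avg_near_quadratic:
  fixes a b c :: real
  assumes "h > 0" "continuous_on (cell x0 h j) u"
    and E: "\<And>x. x \<in> cell x0 h j \<Longrightarrow> \<bar>u x - (a + b * (x - x0) + c * (x - x0)\<^sup>2)\<bar> \<le> E"
  shows "\<bar>cell_avg u x0 h j - (a + b * (j * h) + c * (h\<^sup>2 * (j\<^sup>2 + 1/12)))\<bar> \<le> E"
proof -
  let ?q = "\<lambda>x. a + b * (x - x0) + c * (x - x0)\<^sup>2"
  let ?A = "a + b * (j * h) + c * (h\<^sup>2 * (j\<^sup>2 + 1/12))"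
  have le: "x0 + (j - 1/2) * h \<le> x0 + (j + 1/2) * h" using assms(1) by (simp add: algebra_simps)
  have "u integrable_on cell x0 h j"
    using assms(2) unfolding cell_eq by (rule integrable_continuous_real)
  then have diff: "((\<lambda>x. u x - ?q x) has_integral (integral (cell x0 h j) u - h * ?A)) (cell x0 h j)"
    by (intro has_integral_diff has_integral_quadratic_cell integrable_integral assms(1))
  have "x0 + (j - 1/2) * h \<in> cell x0 h j" using le unfolding cell_eq by simp
  from E[OF this] have "E \<ge> 0" by linarith
  have "norm (integral (cell x0 h j) u - h * ?A)
      \<le> E * measure lborel (cbox (x0 + (j - 1/2) * h) (x0 + (j + 1/2) * h))"
    by (rule has_integral_bound[OF \<open>E \<ge> 0\<close>, of "\<lambda>x. u x - ?q x"])
       (use diff E in \<open>auto simp: cell_eq\<close>)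
  also have "\<dots> = E * h" using le by (simp add: algebra_simps)
  finally have "\<bar>h * (cell_avg u x0 h j - ?A)\<bar> \<le> E * h"
    using assms(1) by (simp add: cell_avg_def right_diff_distrib)
  then show ?thesis using assms(1) by (simp add: abs_mult mult.commute)
qed

section \<open>Approximation orders of the three candidates\<close>

text \<open>The unique parabola with the same averages as \<open>u\<close> over the three cells.\<close>

definition optimal_parabola :: "(real \<Rightarrow> real) \<Rightarrow> real \<Rightarrow> real \<Rightarrow> real \<Rightarrow> real" where
  "optimal_parabola u x0 h x =
     cell_avg u x0 h (3/2) - (sigma_r u x0 h - sigma_l u x0 h) / 24
     + (sigma_r u x0 h + sigma_l u x0 h) / (2 * h) * (x - grid x0 h (3/2))
     + (sigma_r u x0 h - sigma_l u x0 h) / (2 * h\<^sup>2) * (x - grid x0 h (3/2))\<^sup>2"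

lemma optimal_combination:
  assumes "c2 \<noteq> 0" "h > 0"
  shows "c0 * P_0 u x0 h x + c1 * P_1 u x0 h x + c2 * P_2 c0 c1 c2 u x0 h x
       = optimal_parabola u x0 h x"
  using assms unfolding P_0_def P_1_def P_2_def optimal_parabola_def
  by (simp add: field_simps)

text \<open>In the last three conjuncts, the averages of \<open>u\<close> are compared with those of the quadratic
  from the first conjunct.\<close>

definition stencil_data_near ::
  "(real \<Rightarrow> real) \<Rightarrow> real \<Rightarrow> real \<Rightarrow> real \<Rightarrow> real \<Rightarrow> real \<Rightarrow> real \<Rightarrow> bool" where
  "stencil_data_near u x0 h a b c E \<longleftrightarrow>
     (\<forall>x\<in>stencil2 x0 h. \<bar>u x - (a + b * (x - x0) + c * (x - x0)\<^sup>2)\<bar> \<le> E) \<and>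
     \<bar>cell_avg u x0 h (1/2) - (a + b * h / 2 + c * h\<^sup>2 / 3)\<bar> \<le> E \<and>
     \<bar>cell_avg u x0 h (3/2) - (a + 3 * b * h / 2 + 7 * c * h\<^sup>2 / 3)\<bar> \<le> E \<and>
     \<bar>cell_avg u x0 h (5/2) - (a + 5 * b * h / 2 + 19 * c * h\<^sup>2 / 3)\<bar> \<le> E"

text \<open>The common step of the three error estimates: the cell averages that a candidate depends on,
  and the values of \<open>u\<close> that it is compared with, deviate by \<open>O(h\<^sup>k)\<close> from those of one
  polynomial of degree less than \<open>k\<close>, the Taylor polynomial at \<open>x0\<close>.\<close>

lemma stencil_data_near_Taylor_polynomial:
  assumes C: "C_k_on k u {x0 .. x0 + 3 * h0}" and "h0 > 0" "k \<in> {1..3}"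
  shows "\<exists>a b c M. (k < 2 \<longrightarrow> b = 0) \<and> (k < 3 \<longrightarrow> c = 0) \<and> M \<ge> 0 \<and>
    (\<forall>h. 0 < h \<longrightarrow> h \<le> h0 \<longrightarrow> stencil_data_near u x0 h a b c (M * h ^ k))"
proof -
  have k: "Suc (k - 1) = k" using assms(3) by simp
  obtain t M where M: "M \<ge> 0" and
    T: "\<forall>x\<in>{x0..x0 + 3 * h0}. \<bar>u x - (\<Sum>i\<le>k - 1. t i * (x - x0) ^ i)\<bar> \<le> M * (x - x0) ^ k"
    using C_k_on_Taylor[of "k - 1" u x0 "x0 + 3 * h0", unfolded k, OF C] assms(2) by fastforce
  define b where "b = (if k < 2 then 0 else t 1)"
  define c where "c = (if k < 3 then 0 else t 2)"
  have poly: "(\<Sum>i\<le>k - 1. t i * (x - x0) ^ i) = t 0 + b * (x - x0) + c * (x - x0)\<^sup>2" for x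
  proof -
    consider "k = 1" | "k = 2" | "k = 3" using assms(3) unfolding atLeastAtMost_iff by linarith
    then show ?thesis by cases (auto simp: b_def c_def numeral_2_eq_2)
  qed
  define N where "N = M * 3 ^ k"
  have near: "stencil_data_near u x0 h (t 0) b c (N * h ^ k)" if h: "0 < h" "h \<le> h0" for h
  proof -
    have err: "\<bar>u x - (t 0 + b * (x - x0) + c * (x - x0)\<^sup>2)\<bar> \<le> N * h ^ k"
      if "x \<in> stencil2 x0 h" for x
    proof -
      have x: "x0 \<le> x" "x \<le> x0 + 3 * h" using that stencil2_eq[OF h(1)] by auto
      have "\<bar>u x - (t 0 + b * (x - x0) + c * (x - x0)\<^sup>2)\<bar> \<le> M * (x - x0) ^ k"
        using T x h unfolding poly by auto
      also have "\<dots> \<le> M * (3 * h) ^ k"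
        using x M by (intro mult_left_mono power_mono) auto
      finally show ?thesis by (simp add: N_def power_mult_distrib mult_ac)
    qed
    have cont: "continuous_on (stencil2 x0 h) u"
      by (rule continuous_on_subset[OF C_k_on_continuous[OF C]])
         (use stencil2_eq[OF h(1)] h in auto)
    have avg: "\<bar>cell_avg u x0 h j - (t 0 + b * (j * h) + c * (h\<^sup>2 * (j\<^sup>2 + 1/12)))\<bar> \<le> N * h ^ k"
      if "cell x0 h j \<subseteq> stencil2 x0 h" for j
      using that by (intro cell_avg_near_quadratic[OF h(1)] continuous_on_subset[OF cont] err) auto
    have "\<bar>cell_avg u x0 h (1/2) - (t 0 + b * h / 2 + c * h\<^sup>2 / 3)\<bar> \<le> N * h ^ k"
      using avg[of "1/2"] by (auto simp: stencil2_def power2_eq_square algebra_simps)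
    moreover have "\<bar>cell_avg u x0 h (3/2) - (t 0 + 3 * b * h / 2 + 7 * c * h\<^sup>2 / 3)\<bar> \<le> N * h ^ k"
      using avg[of "3/2"] by (auto simp: stencil2_def power2_eq_square algebra_simps)
    moreover have "\<bar>cell_avg u x0 h (5/2) - (t 0 + 5 * b * h / 2 + 19 * c * h\<^sup>2 / 3)\<bar> \<le> N * h ^ k"
      using avg[of "5/2"] by (auto simp: stencil2_def power2_eq_square algebra_simps)
    ultimately show ?thesis using err unfolding stencil_data_near_def by blast
  qed
  show ?thesis
    by (intro exI[of _ "t 0"] exI[of _ b] exI[of _ c] exI[of _ N])
       (use near M in \<open>auto simp: b_def c_def N_def\<close>)
qed

lemma P_0_error:
  assumes "C_k_on 1 u {x0 .. x0 + 3 * h0}" "h0 > 0"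
  shows "\<exists>M\<ge>0. \<forall>h x. 0 < h \<longrightarrow> h \<le> h0 \<longrightarrow> x \<in> stencil2 x0 h \<longrightarrow>
    \<bar>u x - P_0 u x0 h x\<bar> \<le> M * h"
proof -
  obtain a M where M: "M \<ge> 0" and
    near: "\<And>h. 0 < h \<Longrightarrow> h \<le> h0 \<Longrightarrow> stencil_data_near u x0 h a 0 0 (M * h)"
    using stencil_data_near_Taylor_polynomial[OF assms] by auto
  have "\<bar>u x - P_0 u x0 h x\<bar> \<le> (2 * M) * h"
    if h: "0 < h" "h \<le> h0" and x: "x \<in> stencil2 x0 h" for h x
  proof -
    have "\<bar>u x - a\<bar> \<le> M * h" "\<bar>cell_avg u x0 h (1/2) - a\<bar> \<le> M * h"
      using near[OF h] x unfolding stencil_data_near_def by auto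
    then show ?thesis unfolding P_0_def mult.assoc by linarith
  qed
  with M show ?thesis by (intro exI[of _ "2 * M"]) auto
qed

lemma P_1_error:
  assumes "C_k_on 2 u {x0 .. x0 + 3 * h0}" "h0 > 0"
  shows "\<exists>M\<ge>0. \<forall>h x. 0 < h \<longrightarrow> h \<le> h0 \<longrightarrow> x \<in> stencil2 x0 h \<longrightarrow>
    \<bar>u x - P_1 u x0 h x\<bar> \<le> M * h\<^sup>2"
proof -
  obtain a b M where M: "M \<ge> 0" and
    near: "\<And>h. 0 < h \<Longrightarrow> h \<le> h0 \<Longrightarrow> stencil_data_near u x0 h a b 0 (M * h\<^sup>2)"
    using stencil_data_near_Taylor_polynomial[OF assms] by auto
  have "\<bar>u x - P_1 u x0 h x\<bar> \<le> (5 * M) * h\<^sup>2"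
    if h: "0 < h" "h \<le> h0" and x: "x \<in> stencil2 x0 h" for h x
  proof -
    define E where "E = M * h\<^sup>2"
    define s where "s = (x - grid x0 h (3/2)) / h"
    define e where "e = u x - (a + b * (x - x0))"
    define e0 where "e0 = cell_avg u x0 h (1/2) - (a + b * h / 2)"
    define e1 where "e1 = cell_avg u x0 h (3/2) - (a + 3 * b * h / 2)"
    have E: "\<bar>e\<bar> \<le> E" "\<bar>e0\<bar> \<le> E" "\<bar>e1\<bar> \<le> E"
      using near[OF h] x unfolding stencil_data_near_def E_def e_def e0_def e1_def by auto
    have s: "\<bar>s\<bar> \<le> 3/2"
      using x h(1) unfolding stencil2_eq[OF h(1)] s_def grid_def
      by (auto simp: abs_le_iff field_simps)
    \<comment> \<open>The line through the two averages reproduces \<open>a + b * (x - x0)\<close>, which therefore cancels.\<close>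
    have "u x - P_1 u x0 h x = e - e1 - (e1 - e0) * s"
      using h(1) unfolding P_1_def sigma_l_def e_def e0_def e1_def s_def grid_def
      by (simp add: field_simps)
    moreover have "\<bar>(e1 - e0) * s\<bar> \<le> (2 * E) * (3/2)"
      unfolding abs_mult using E s by (intro mult_mono) auto
    ultimately have "\<bar>u x - P_1 u x0 h x\<bar> \<le> 5 * E" using E by linarith
    then show ?thesis by (simp add: E_def)
  qed
  with M show ?thesis by (intro exI[of _ "5 * M"]) auto
qed

lemma optimal_parabola_error:
  assumes "C_k_on 3 u {x0 .. x0 + 3 * h0}" "h0 > 0"
  shows "\<exists>M\<ge>0. \<forall>h x. 0 < h \<longrightarrow> h \<le> h0 \<longrightarrow> x \<in> stencil2 x0 h \<longrightarrow>
    \<bar>u x - optimal_parabola u x0 h x\<bar> \<le> M * h ^ 3"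
proof -
  obtain a b c M where M: "M \<ge> 0" and
    near: "\<And>h. 0 < h \<Longrightarrow> h \<le> h0 \<Longrightarrow> stencil_data_near u x0 h a b c (M * h ^ 3)"
    using stencil_data_near_Taylor_polynomial[OF assms] by auto
  have "\<bar>u x - optimal_parabola u x0 h x\<bar> \<le> (9 * M) * h ^ 3"
    if h: "0 < h" "h \<le> h0" and x: "x \<in> stencil2 x0 h" for h x
  proof -
    define E where "E = M * h ^ 3"
    define s where "s = (x - grid x0 h (3/2)) / h"
    define e where "e = u x - (a + b * (x - x0) + c * (x - x0)\<^sup>2)"
    define e0 where "e0 = cell_avg u x0 h (1/2) - (a + b * h / 2 + c * h\<^sup>2 / 3)"
    define e1 where "e1 = cell_avg u x0 h (3/2) - (a + 3 * b * h / 2 + 7 * c * h\<^sup>2 / 3)"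
    define e2 where "e2 = cell_avg u x0 h (5/2) - (a + 5 * b * h / 2 + 19 * c * h\<^sup>2 / 3)"
    have E: "\<bar>e\<bar> \<le> E" "\<bar>e0\<bar> \<le> E" "\<bar>e1\<bar> \<le> E" "\<bar>e2\<bar> \<le> E"
      using near[OF h] x unfolding stencil_data_near_def E_def e_def e0_def e1_def e2_def by auto
    have s: "\<bar>s\<bar> \<le> 3/2"
      using x h(1) unfolding stencil2_eq[OF h(1)] s_def grid_def by (auto simp: abs_le_iff field_simps)
    define g where "g = e2 - e0"
    define d where "d = e2 - 2 * e1 + e0"
    have g: "\<bar>g\<bar> \<le> 2 * E" and d: "\<bar>d\<bar> \<le> 4 * E"
      using E unfolding g_def d_def by linarith+
    \<comment> \<open>Here \<open>a\<close>, \<open>b\<close> and \<open>c\<close> cancel: the optimal parabola of a quadratic is that quadratic.\<close>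
    have "u x - optimal_parabola u x0 h x = e - e1 + d / 24 - g / 2 * s - d / 2 * s\<^sup>2"
    proof -
      have x_eq: "x = x0 + (3/2 + s) * h"
        using h(1) by (simp add: s_def grid_def field_simps)
      have u: "u x = e + (a + b * ((3/2 + s) * h) + c * ((3/2 + s) * h)\<^sup>2)"
        unfolding e_def x_eq by simp
      have avg: "cell_avg u x0 h (1/2) = e0 + (a + b * h / 2 + c * h\<^sup>2 / 3)"
        "cell_avg u x0 h (3/2) = e1 + (a + 3 * b * h / 2 + 7 * c * h\<^sup>2 / 3)"
        "cell_avg u x0 h (5/2) = e2 + (a + 5 * b * h / 2 + 19 * c * h\<^sup>2 / 3)"
        unfolding e0_def e1_def e2_def by auto
      have y: "x - grid x0 h (3/2) = s * h" using h(1) by (simp add: s_def)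
      show ?thesis
        using h(1)
        unfolding optimal_parabola_def sigma_l_def sigma_r_def u avg y g_def d_def
        by (simp add: field_simps power2_eq_square)
    qed
    moreover have "\<bar>g / 2 * s\<bar> \<le> E * (3/2)"
      unfolding abs_mult using g s by (intro mult_mono) auto
    moreover have "\<bar>d / 2 * s\<^sup>2\<bar> \<le> (2 * E) * (9/4)"
    proof -
      have "\<bar>s\<bar>\<^sup>2 \<le> (3/2)\<^sup>2" using s by (intro power_mono) auto
      then have "\<bar>s\<^sup>2\<bar> \<le> 9/4" by (simp add: power2_eq_square)
      then show ?thesis unfolding abs_mult using d by (intro mult_mono) auto
    qed
    ultimately have "\<bar>u x - optimal_parabola u x0 h x\<bar> \<le> 9 * E"
      using E(1,3) d by linarith
    then show ?thesis by (simp add: E_def)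
  qed
  with M show ?thesis by (intro exI[of _ "9 * M"]) auto
qed

section \<open>The optimal weights\<close>

lemma opt_weight_nonneg: "K > 0 \<Longrightarrow> opt_weight K \<gamma> h \<ge> 0"
  by (simp add: opt_weight_def)

lemma opt_weight_le_linear:
  assumes "K > 0" "\<gamma> \<ge> 1" "0 < h" "h \<le> 1"
  shows "opt_weight K \<gamma> h \<le> K * h"
  using powr_mono'[of 1 \<gamma> h] assms by (simp add: opt_weight_def)

text \<open>A positive function may tend to \<open>0\<close>, so the shape of \<open>c2\<close> matters. For \<open>\<gamma>1 > 0\<close> the limit
  is \<open>1\<close>. For \<open>\<gamma>1 = 0\<close> positivity forces \<open>K1 < 1\<close>, as \<open>c2 = 1 - K1 - K0 * h powr \<gamma>0\<close> with
  a positive subtrahend, and the limit \<open>1 - K1\<close> is again positive.\<close>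

lemma opt_weight2_bounded_away_from_0:
  assumes "K0 > 0" "\<gamma>0 > 0" "\<gamma>1 \<ge> 0"
    and pos: "\<forall>\<^sub>F h in at_right 0. opt_weight2 K0 \<gamma>0 K1 \<gamma>1 h > 0"
  shows "\<exists>\<delta>>0. \<forall>\<^sub>F h in at_right 0. opt_weight2 K0 \<gamma>0 K1 \<gamma>1 h \<ge> \<delta>"
proof -
  have vanish: "((\<lambda>h. h powr \<gamma>) \<longlongrightarrow> 0) (at_right (0::real))" if "\<gamma> > 0" for \<gamma> :: real
    using that by (auto intro!: tendsto_eq_intros simp: eventually_at_right_less eventually_at_filter)
  have "\<exists>L>0. (opt_weight2 K0 \<gamma>0 K1 \<gamma>1 \<longlongrightarrow> L) (at_right 0)"
  proof (cases "\<gamma>1 = 0")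
    case False
    then have "((\<lambda>h. 1 - K0 * h powr \<gamma>0 - K1 * h powr \<gamma>1) \<longlongrightarrow> 1 - K0 * 0 - K1 * 0) (at_right 0)"
      using assms by (intro tendsto_intros vanish) auto
    then show ?thesis
      unfolding opt_weight2_def by (intro exI[of _ 1]) simp
  next
    case True
    have h_pos: "\<forall>\<^sub>F h in at_right (0::real). h > 0" by (rule eventually_at_right_less)
    obtain h where h: "opt_weight2 K0 \<gamma>0 K1 \<gamma>1 h > 0" "h > 0"
      using eventually_happens'[OF trivial_limit_at_right_real eventually_conj[OF pos h_pos]] by blast
    have "K0 * h powr \<gamma>0 > 0" using assms(1) h(2) by simp
    with h True have "1 - K1 > 0" by (simp add: opt_weight2_def)
    have "((\<lambda>h. 1 - K0 * h powr \<gamma>0 - K1) \<longlongrightarrow> 1 - K0 * 0 - K1) (at_right 0)"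
      using assms by (intro tendsto_intros vanish) auto
    moreover have "\<forall>\<^sub>F h in at_right 0. 1 - K0 * h powr \<gamma>0 - K1 = opt_weight2 K0 \<gamma>0 K1 \<gamma>1 h"
      using h_pos by eventually_elim (simp add: opt_weight2_def True)
    ultimately have "(opt_weight2 K0 \<gamma>0 K1 \<gamma>1 \<longlongrightarrow> 1 - K1) (at_right 0)"
      using tendsto_cong by force
    with \<open>1 - K1 > 0\<close> show ?thesis by blast
  qed
  then obtain L where "L > 0" "(opt_weight2 K0 \<gamma>0 K1 \<gamma>1 \<longlongrightarrow> L) (at_right 0)" by blast
  then have "\<forall>\<^sub>F h in at_right 0. L / 2 < opt_weight2 K0 \<gamma>0 K1 \<gamma>1 h"
    by (intro order_tendstoD(1)[of _ L]) auto
  then show ?thesis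
    using \<open>L > 0\<close> by (intro exI[of _ "L / 2"]) (auto elim: eventually_mono)
qed

section \<open>Convex combinations with nearly optimal weights\<close>

text \<open>The values at a single point: \<open>v\<close> is the exact one. Nothing is assumed about \<open>p2\<close> itself, as
  the candidate \<open>P_2\<close> is accessible only through the optimal combination; the quotient by
  \<open>\<delta>\<close> in the bound is the constant of the second-order error of \<open>p2\<close> that results.\<close>

lemma nearly_optimal_combination_error:
  fixes h :: real
  assumes h: "0 < h" "h \<le> 1"
    and c: "0 \<le> c0" "c0 \<le> K * h" "0 \<le> c1" "c0 + c1 + c2 = 1" "0 < \<delta>" "\<delta> \<le> c2"
    and w: "w0 + w1 + w2 = 1"
    and B: "\<bar>w0 - c0\<bar> \<le> B0 * h\<^sup>2" "\<bar>w1 - c1\<bar> \<le> B1 * h" "\<bar>w2 - c2\<bar> \<le> B2 * h"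
    and M: "M0 \<ge> 0" "M1 \<ge> 0" "M \<ge> 0"
    and p: "\<bar>v - p0\<bar> \<le> M0 * h" "\<bar>v - p1\<bar> \<le> M1 * h\<^sup>2"
      "\<bar>v - (c0 * p0 + c1 * p1 + c2 * p2)\<bar> \<le> M * h ^ 3"
  shows "\<bar>v - (w0 * p0 + w1 * p1 + w2 * p2)\<bar>
    \<le> (M + B0 * M0 + B1 * M1 + B2 * ((M + K * M0 + M1) / \<delta>)) * h ^ 3"
proof -
  let ?q = "c0 * p0 + c1 * p1 + c2 * p2"
  have Bnonneg: "0 \<le> B0 * h\<^sup>2" "0 \<le> B1 * h" "0 \<le> B2 * h" using B by linarith+
  have "c1 \<le> 1" using c by linarith
  have h3: "h ^ 3 \<le> h\<^sup>2" using h by (intro power_decreasing) auto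
  have "\<delta> * \<bar>v - p2\<bar> \<le> \<bar>c2 * (v - p2)\<bar>"
    using c by (simp add: abs_mult mult_right_mono)
  also have "c2 * (v - p2) = (v - ?q) - c0 * (v - p0) - c1 * (v - p1)"
  proof -
    have c2: "c2 = 1 - c0 - c1" using c by linarith
    show ?thesis unfolding c2 by (simp add: algebra_simps)
  qed
  also have "\<bar>\<dots>\<bar> \<le> \<bar>v - ?q\<bar> + \<bar>c0 * (v - p0)\<bar> + \<bar>c1 * (v - p1)\<bar>" by linarith
  also have "\<dots> \<le> M * h\<^sup>2 + (K * h) * (M0 * h) + 1 * (M1 * h\<^sup>2)"
  proof (intro add_mono)
    show "\<bar>v - ?q\<bar> \<le> M * h\<^sup>2" using p(3) mult_left_mono[OF h3 M(3)] by linarith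
    show "\<bar>c0 * (v - p0)\<bar> \<le> (K * h) * (M0 * h)"
      unfolding abs_mult using c p by (intro mult_mono) auto
    show "\<bar>c1 * (v - p1)\<bar> \<le> 1 * (M1 * h\<^sup>2)"
      unfolding abs_mult using c p \<open>c1 \<le> 1\<close> by (intro mult_mono) auto
  qed
  also have "\<dots> = (M + K * M0 + M1) * h\<^sup>2"
    by (simp add: algebra_simps power2_eq_square)
  finally have p2: "\<bar>v - p2\<bar> \<le> (M + K * M0 + M1) / \<delta> * h\<^sup>2"
    using c by (simp add: field_simps)
  have "v - (w0 * p0 + w1 * p1 + w2 * p2)
      = (v - ?q) + (w0 - c0) * (v - p0) + (w1 - c1) * (v - p1) + (w2 - c2) * (v - p2)"
  proof -
    have w2: "w2 = 1 - w0 - w1" and c2: "c2 = 1 - c0 - c1" using c w by linarith+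
    show ?thesis unfolding w2 c2 by (simp add: algebra_simps)
  qed
  also have "\<bar>\<dots>\<bar> \<le> \<bar>v - ?q\<bar> + \<bar>(w0 - c0) * (v - p0)\<bar> + \<bar>(w1 - c1) * (v - p1)\<bar>
      + \<bar>(w2 - c2) * (v - p2)\<bar>" by linarith
  also have "\<dots> \<le> M * h ^ 3 + (B0 * h\<^sup>2) * (M0 * h) + (B1 * h) * (M1 * h\<^sup>2)
      + (B2 * h) * ((M + K * M0 + M1) / \<delta> * h\<^sup>2)"
    unfolding abs_mult using p B p2 Bnonneg by (intro add_mono mult_mono) auto
  also have "\<dots> = (M + B0 * M0 + B1 * M1 + B2 * ((M + K * M0 + M1) / \<delta>)) * h ^ 3"
    by (simp add: algebra_simps power2_eq_square power3_eq_cube)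
  finally show ?thesis .
qed

theorem theorem2p1:
  shows "\<exists>k::nat. \<forall>(u :: real \<Rightarrow> real) (x0 :: real) (h0 :: real)
      (K0 :: real) (K1 :: real) (\<gamma>0 :: real) (\<gamma>1 :: real)
      (c0 :: real \<Rightarrow> real) (c1 :: real \<Rightarrow> real) (c2 :: real \<Rightarrow> real)
      (\<omega>0 :: real \<Rightarrow> real) (\<omega>1 :: real \<Rightarrow> real) (\<omega>2 :: real \<Rightarrow> real)
      (P :: real \<Rightarrow> real \<Rightarrow> real).
    K0 > 0 \<longrightarrow> K1 > 0 \<longrightarrow> \<gamma>1 \<ge> 0 \<longrightarrow> \<gamma>0 \<ge> 1 \<longrightarrow> \<gamma>0 \<ge> \<gamma>1 \<longrightarrow>
    c0 = opt_weight K0 \<gamma>0 \<longrightarrow>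
    c1 = opt_weight K1 \<gamma>1 \<longrightarrow>
    c2 = opt_weight2 K0 \<gamma>0 K1 \<gamma>1 \<longrightarrow>
    (\<forall>\<^sub>F h in at_right 0. c0 h > 0 \<and> c1 h > 0 \<and> c2 h > 0) \<longrightarrow>
    (\<forall>\<^sub>F h in at_right 0. \<omega>0 h \<ge> 0 \<and> \<omega>1 h \<ge> 0 \<and> \<omega>2 h \<ge> 0 \<and> \<omega>0 h + \<omega>1 h + \<omega>2 h = 1) \<longrightarrow>
    P = (\<lambda>h x. \<omega>0 h * P_0 u x0 h x + \<omega>1 h * P_1 u x0 h x
                 + \<omega>2 h * P_2 (c0 h) (c1 h) (c2 h) u x0 h x) \<longrightarrow>
    h0 > 0 \<longrightarrow> C_k_on k u {x0 .. x0 + 3 * h0} \<longrightarrow>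
    (\<lambda>h. \<omega>0 h - c0 h) \<in> O[at_right 0](\<lambda>h. h\<^sup>2) \<longrightarrow>
    (\<lambda>h. \<omega>1 h - c1 h) \<in> O[at_right 0](\<lambda>h. h) \<longrightarrow>
    (\<lambda>h. \<omega>2 h - c2 h) \<in> O[at_right 0](\<lambda>h. h) \<longrightarrow>
    (\<exists>C. \<forall>\<^sub>F h in at_right 0. \<forall>x \<in> stencil2 x0 h. \<bar>u x - P h x\<bar> \<le> C * h ^ 3)"
proof (rule exI[of _ 3], intro allI impI)
  \<comment> \<open>Three derivatives, for the cubic Taylor remainder behind the error of the optimal parabola.\<close>
  fix u :: "real \<Rightarrow> real" and x0 h0 K0 K1 \<gamma>0 \<gamma>1 :: real
    and c0 c1 c2 \<omega>0 \<omega>1 \<omega>2 :: "real \<Rightarrow> real" and P :: "real \<Rightarrow> real \<Rightarrow> real"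
  assume K: "K0 > 0" "K1 > 0" and \<gamma>: "\<gamma>1 \<ge> 0" "\<gamma>0 \<ge> 1"
    and c: "c0 = opt_weight K0 \<gamma>0" "c1 = opt_weight K1 \<gamma>1" "c2 = opt_weight2 K0 \<gamma>0 K1 \<gamma>1"
    and c_pos: "\<forall>\<^sub>F h in at_right 0. c0 h > 0 \<and> c1 h > 0 \<and> c2 h > 0"
    and \<omega>: "\<forall>\<^sub>F h in at_right 0.
          \<omega>0 h \<ge> 0 \<and> \<omega>1 h \<ge> 0 \<and> \<omega>2 h \<ge> 0 \<and> \<omega>0 h + \<omega>1 h + \<omega>2 h = 1"
    and P: "P = (\<lambda>h x. \<omega>0 h * P_0 u x0 h x + \<omega>1 h * P_1 u x0 h x
                 + \<omega>2 h * P_2 (c0 h) (c1 h) (c2 h) u x0 h x)"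
    and h0: "h0 > 0" and C3: "C_k_on 3 u {x0 .. x0 + 3 * h0}"
    and O0: "(\<lambda>h. \<omega>0 h - c0 h) \<in> O[at_right 0](\<lambda>h. h\<^sup>2)"
    and O1: "(\<lambda>h. \<omega>1 h - c1 h) \<in> O[at_right 0](\<lambda>h. h)"
    and O2: "(\<lambda>h. \<omega>2 h - c2 h) \<in> O[at_right 0](\<lambda>h. h)"
  have C: "C_k_on 1 u {x0 .. x0 + 3 * h0}" "C_k_on 2 u {x0 .. x0 + 3 * h0}"
    using C_k_on_mono[OF C3] by auto
  obtain M0 where M0: "M0 \<ge> 0" "\<And>h x. 0 < h \<Longrightarrow> h \<le> h0 \<Longrightarrow> x \<in> stencil2 x0 h \<Longrightarrow>
      \<bar>u x - P_0 u x0 h x\<bar> \<le> M0 * h"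
    using P_0_error[OF C(1) h0] by blast
  obtain M1 where M1: "M1 \<ge> 0" "\<And>h x. 0 < h \<Longrightarrow> h \<le> h0 \<Longrightarrow> x \<in> stencil2 x0 h \<Longrightarrow>
      \<bar>u x - P_1 u x0 h x\<bar> \<le> M1 * h\<^sup>2"
    using P_1_error[OF C(2) h0] by blast
  obtain M where M: "M \<ge> 0" "\<And>h x. 0 < h \<Longrightarrow> h \<le> h0 \<Longrightarrow> x \<in> stencil2 x0 h \<Longrightarrow>
      \<bar>u x - optimal_parabola u x0 h x\<bar> \<le> M * h ^ 3"
    using optimal_parabola_error[OF C3 h0] by blast
  have "\<forall>\<^sub>F h in at_right 0. opt_weight2 K0 \<gamma>0 K1 \<gamma>1 h > 0"
    using c_pos unfolding c by (rule eventually_mono) auto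
  then obtain \<delta> where \<delta>: "\<delta> > 0" "\<forall>\<^sub>F h in at_right 0. c2 h \<ge> \<delta>"
    using opt_weight2_bounded_away_from_0[of K0 \<gamma>0 \<gamma>1 K1] K \<gamma> unfolding c by auto
  obtain B0 where B0: "\<forall>\<^sub>F h in at_right 0. norm (\<omega>0 h - c0 h) \<le> B0 * norm (h\<^sup>2)"
    using O0 by (elim landau_o.bigE)
  obtain B1 where B1: "\<forall>\<^sub>F h in at_right 0. norm (\<omega>1 h - c1 h) \<le> B1 * norm h"
    using O1 by (elim landau_o.bigE)
  obtain B2 where B2: "\<forall>\<^sub>F h in at_right 0. norm (\<omega>2 h - c2 h) \<le> B2 * norm h"
    using O2 by (elim landau_o.bigE)
  have small: "\<forall>\<^sub>F h in at_right (0::real). 0 < h \<and> h < min h0 1"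
    using h0 by (intro eventually_conj eventually_at_right_less eventually_at_right_real[THEN eventually_mono, of 0 "min h0 1"]) auto
  show "\<exists>C. \<forall>\<^sub>F h in at_right 0. \<forall>x\<in>stencil2 x0 h. \<bar>u x - P h x\<bar> \<le> C * h ^ 3"
  proof (intro exI)
    show "\<forall>\<^sub>F h in at_right 0. \<forall>x\<in>stencil2 x0 h. \<bar>u x - P h x\<bar>
        \<le> (M + B0 * M0 + B1 * M1 + B2 * ((M + K0 * M0 + M1) / \<delta>)) * h ^ 3"
      using \<omega> \<delta>(2) B0 B1 B2 small
    proof eventually_elim
      case (elim h)
      then have h: "0 < h" "h \<le> h0" "h \<le> 1" by auto
      have opt: "0 \<le> c0 h" "c0 h \<le> K0 * h" "0 \<le> c1 h"
        using K \<gamma> h by (auto simp: c opt_weight_nonneg opt_weight_le_linear)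
      have sum: "c0 h + c1 h + c2 h = 1" by (simp add: c opt_weight_def opt_weight2_def)
      have "c2 h \<noteq> 0" using elim(2) \<delta>(1) by linarith
      show ?case
      proof
        fix x assume x: "x \<in> stencil2 x0 h"
        show "\<bar>u x - P h x\<bar>
          \<le> (M + B0 * M0 + B1 * M1 + B2 * ((M + K0 * M0 + M1) / \<delta>)) * h ^ 3"
          unfolding P
          by (rule nearly_optimal_combination_error[OF h(1,3) opt sum \<delta>(1) elim(2)])
             (use elim h x M0 M1 M optimal_combination[OF \<open>c2 h \<noteq> 0\<close> h(1)] in auto)
      qed
    qed
  qed
qed

end
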